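(* Let $G$ be a finite commutative group with $|G|=q$. Let $k\ge 2$ and $l\ge 0$ be integers and let $A\subseteq G$ be a set whose representation function satisfies $r(x)\le k$ if $x\notin 2\cdot A$ and $r(x)\le k+l$ if $x\in 2\cdot A$. Then $$|A|<\sqrt{(k-1)q}+1+\frac{l}{2}+\frac{l(l+1)}{2(k-1)}.$$
   Context: For $A\subseteq G$, the representation function is $r(x)=\#\{(a_1,a_2): a_1,a_2\in A,\ a_1+a_2=x\}$ (ordered pairs), and $2\cdot A=\{2a: a\in A\}$. *)

theory Defs
  imports Complex_Main "HOL-Library.Cardinality"
begin

(* Ordered pairs are counted; a1 = a2 is allowed. *)
definition rep :: "'a::ab_group_add set \<Rightarrow> 'a \<Rightarrow> nat" where
  "rep A x = card {(a1, a2). a1 \<in> A \<and> a2 \<in> A \<and> a1 + a2 = x}"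

(* The set 2.A of doubles of elements of A, as opposed to the sumset A + A;
   a + a because the group has no numeral 2. *)
definition doubles :: "'a::ab_group_add set \<Rightarrow> 'a set" where
  "doubles A = {a + a | a. a \<in> A}"

end

theory Submission
  imports Defs "HOL-Analysis.Convex"
begin

text \<open>
  Let \<open>n = card A\<close> and let \<open>d x\<close> be the number of representations of \<open>x\<close> as a difference of two
  elements of \<open>A\<close>. The equations \<open>a + b = c + e\<close> and \<open>a - c = e - b\<close> are equivalent, so \<open>r\<close> and
  \<open>d\<close> have the same sum of squares. Since \<open>d 0 = n\<close>, Cauchy-Schwarz on the nonzero differences
  bounds this sum from below by \<open>n\<^sup>2 + (n (n - 1))\<^sup>2 / (q - 1)\<close>, while the hypotheses bound it from
  above by \<open>k n\<^sup>2 + l (k + l) n\<close>, because \<open>2 \<cdot> A\<close> has at most \<open>n\<close> elements. Comparing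
  the two bounds at \<open>n \<ge> sqrt ((k - 1) q)\<close> gives the theorem.
\<close>

lemma sum_card_fibre:
  fixes f :: "'b \<Rightarrow> 'a::finite"
  assumes "finite S"
  shows "(\<Sum>x\<in>UNIV. card {p\<in>S. f p = x}) = card S"
  using sum.group[of S UNIV f "\<lambda>_. 1::nat"] assms by simp

text \<open>A pair of points in a common fibre determines that fibre, so the squares count such
  pairs without overlap.\<close>

lemma sum_card_fibre_squared:
  fixes f :: "'b \<Rightarrow> 'a::finite"
  assumes "finite S"
  shows "(\<Sum>x\<in>UNIV. (card {p\<in>S. f p = x})\<^sup>2) = card {(p, p'). p \<in> S \<and> p' \<in> S \<and> f p = f p'}"
proof -
  let ?T = "{(p, p'). p \<in> S \<and> p' \<in> S \<and> f p = f p'}"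
  have "finite ?T"
    by (rule finite_subset[of _ "S \<times> S"]) (use assms in auto)
  then have "card ?T = (\<Sum>x\<in>UNIV. card {t\<in>?T. f (fst t) = x})"
    by (rule sum_card_fibre[symmetric])
  moreover have "{t\<in>?T. f (fst t) = x} = {p\<in>S. f p = x} \<times> {p\<in>S. f p = x}" for x
    by auto
  ultimately show ?thesis
    by (simp add: card_cartesian_product power2_eq_square)
qed

definition diff_rep :: "'a::ab_group_add set \<Rightarrow> 'a \<Rightarrow> nat" where
  "diff_rep A x = card {p \<in> A \<times> A. fst p - snd p = x}"

lemma rep_eq_fibre: "rep A x = card {p \<in> A \<times> A. fst p + snd p = x}"
  unfolding rep_def by (rule arg_cong[where f = card]) auto

lemma diff_rep_0: "diff_rep A 0 = card A"
proof -
  have "{p \<in> A \<times> A. fst p - snd p = 0} = (\<lambda>a. (a, a)) ` A"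
    by auto
  then show ?thesis
    by (simp add: diff_rep_def card_image inj_on_def)
qed

lemma sum_rep: "(\<Sum>x\<in>UNIV. rep A x) = (card A)\<^sup>2"
  for A :: "'a::{ab_group_add, finite} set"
  by (simp add: rep_eq_fibre sum_card_fibre card_cartesian_product power2_eq_square)

lemma sum_diff_rep: "(\<Sum>x\<in>UNIV. diff_rep A x) = (card A)\<^sup>2"
  for A :: "'a::{ab_group_add, finite} set"
  by (simp add: diff_rep_def sum_card_fibre card_cartesian_product power2_eq_square)

lemma sum_rep_squared_eq_sum_diff_rep_squared:
  fixes A :: "'a::{ab_group_add, finite} set"
  shows "(\<Sum>x\<in>UNIV. (rep A x)\<^sup>2) = (\<Sum>x\<in>UNIV. (diff_rep A x)\<^sup>2)"
  unfolding rep_eq_fibre diff_rep_def sum_card_fibre_squared[OF finite]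
  \<comment> \<open>Both sides now count quadruples from \<open>A\<close>; the bijection only
    regroups their entries.\<close>
  by (rule bij_betw_same_card[where f = "\<lambda>((a, b), (c, e)). ((a, c), (e, b))"],
      rule bij_betwI[where g = "\<lambda>((a, c), (e, b)). ((a, b), (c, e))"])
    (auto simp: algebra_simps)

text \<open>Splitting off the difference 0 sharpens Cauchy-Schwarz. The product form avoids dividing
  by \<open>q - 1\<close>, which is 0 in the trivial group.\<close>

lemma sum_diff_rep_squared_ge:
  fixes A :: "'a::{ab_group_add, finite} set"
  defines "n \<equiv> real (card A)"
  shows "(n * (n - 1))\<^sup>2 \<le> (real CARD('a) - 1) * ((\<Sum>x\<in>UNIV. (real (diff_rep A x))\<^sup>2) - n\<^sup>2)"
proof -
  have "(\<Sum>x\<in>UNIV. real (diff_rep A x)) = n\<^sup>2"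
    by (simp add: n_def sum_diff_rep flip: of_nat_sum)
  then have "(\<Sum>x\<in>UNIV - {0}. real (diff_rep A x)) = n * (n - 1)"
    by (simp add: sum_diff1 diff_rep_0 n_def power2_eq_square algebra_simps)
  moreover have "(\<Sum>x\<in>UNIV - {0}. (real (diff_rep A x))\<^sup>2) = (\<Sum>x\<in>UNIV. (real (diff_rep A x))\<^sup>2) - n\<^sup>2"
    by (simp add: sum_diff1 diff_rep_0 n_def)
  moreover have "real (card (UNIV - {0::'a})) = real CARD('a) - 1"
    by (simp add: card_Diff_singleton of_nat_diff Suc_leI)
  ultimately show ?thesis
    using Cauchy_Schwarz_ineq_sum[of "\<lambda>_. 1" "\<lambda>x. real (diff_rep A x)" "UNIV - {0}"] by simp
qed

lemma sum_rep_squared_le: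
  fixes A :: "'a::{ab_group_add, finite} set"
  assumes out: "\<And>x. x \<notin> doubles A \<Longrightarrow> rep A x \<le> k"
    and "in": "\<And>x. x \<in> doubles A \<Longrightarrow> rep A x \<le> k + l"
  shows "(\<Sum>x\<in>UNIV. (rep A x)\<^sup>2) \<le> k * (card A)\<^sup>2 + l * (k + l) * card A"
proof -
  have "(rep A x)\<^sup>2 \<le> k * rep A x + (if x \<in> doubles A then l * (k + l) else 0)" for x
  proof (cases "x \<in> doubles A")
    case True
    \<comment> \<open>The bound \<open>k + l\<close> is used twice: for one factor of the square,
      then for the excess \<open>l * rep A x\<close>.\<close>
    have "(rep A x)\<^sup>2 \<le> (k + l) * rep A x"
      using "in"[OF True] by (simp add: power2_eq_square mult_right_mono)
    also have "\<dots> \<le> k * rep A x + l * (k + l)"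
      using "in"[OF True] by (simp add: distrib_right mult_left_mono)
    finally show ?thesis
      using True by simp
  qed (use out in \<open>simp add: power2_eq_square mult_right_mono\<close>)
  then have "(\<Sum>x\<in>UNIV. (rep A x)\<^sup>2)
      \<le> (\<Sum>x\<in>UNIV. k * rep A x + (if x \<in> doubles A then l * (k + l) else 0))"
    by (rule sum_mono)
  also have "\<dots> = k * (card A)\<^sup>2 + l * (k + l) * card (doubles A)"
    by (simp add: sum.distrib sum.If_cases sum_rep mult.commute flip: sum_distrib_left)
  also have "card (doubles A) \<le> card A"
    using card_image_le[of A "\<lambda>a. a + a"] by (simp add: doubles_def image_def setcompr_eq_image)
  finally show ?thesis
    by simp
qed

text \<open>To be used with \<open>m = k - 1\<close> and \<open>c\<close> the part of the bound
  depending on \<open>l\<close>. A counterexample has \<open>s + c \<le> n - 1\<close>, and the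
  chain squeezes \<open>n * (n - 1)\<^sup>2\<close> strictly below itself.\<close>

lemma real_bound_of_energy_bound:
  fixes n q m c :: real
  assumes "q \<ge> 1" "m > 0" "c \<ge> 0"
    and le: "(n * (n - 1))\<^sup>2 \<le> (q - 1) * (m * (n\<^sup>2 + 2 * c * n))"
  shows "n < sqrt (m * q) + 1 + c"
proof (rule ccontr)
  define s where "s = sqrt (m * q)"
  have s: "s \<ge> 0" "s\<^sup>2 = m * q"
    using assms by (simp_all add: s_def)
  assume "\<not> n < sqrt (m * q) + 1 + c"
  then have n: "s + c \<le> n - 1"
    by (simp add: s_def)
  then have "n \<ge> 1" "s \<le> n"
    using s assms by auto
  have "n * (n * (n - 1)\<^sup>2) \<le> n * ((q - 1) * m * (n + 2 * c))"
    using le by (simp add: power2_eq_square algebra_simps)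
  then have "n * (n - 1)\<^sup>2 \<le> (q - 1) * m * (n + 2 * c)"
    using \<open>n \<ge> 1\<close> by simp
  also have "\<dots> = s\<^sup>2 * n + s * (2 * c * s) - m * (n + 2 * c)"
    unfolding mult.left_commute[of s] mult.assoc power2_eq_square[symmetric] s
    using s(2) by (simp add: algebra_simps power2_eq_square)
  \<comment> \<open>The strictness comes from the 1 in \<open>q - 1\<close>.\<close>
  also have "\<dots> < s\<^sup>2 * n + s * (2 * c * s)"
    using assms \<open>n \<ge> 1\<close> by simp
  \<comment> \<open>Trading one \<open>s\<close> for \<open>n\<close> makes \<open>n\<close> a
    common factor; adding \<open>n * c\<^sup>2\<close> then completes the square.\<close>
  also have "\<dots> \<le> s\<^sup>2 * n + s * (2 * c * n)"
    using s assms \<open>s \<le> n\<close> by (simp add: mult_left_mono)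
  also have "\<dots> \<le> n * (s + c)\<^sup>2"
    using \<open>n \<ge> 1\<close> by (simp add: power2_sum algebra_simps)
  also have "\<dots> \<le> n * (n - 1)\<^sup>2"
    using n s assms \<open>n \<ge> 1\<close> by (intro mult_left_mono power_mono) auto
  finally show False
    by simp
qed

theorem theorem3:
  fixes A :: "'a::{ab_group_add, finite} set" and q k l :: nat
  assumes "CARD('a) = q"
    and "k \<ge> 2"
    and "\<And>x. x \<notin> doubles A \<Longrightarrow> rep A x \<le> k"
    and "\<And>x. x \<in> doubles A \<Longrightarrow> rep A x \<le> k + l"
  shows "real (card A) <
    sqrt ((real k - 1) * real q) + 1 + real l / 2 + real l * (real l + 1) / (2 * (real k - 1))"
proof -
  define n where "n = real (card A)"
  \<comment> \<open>This value solves \<open>2 * c * (k - 1) = l * (k + l)\<close>, since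
    \<open>k + l = (k - 1) + (l + 1)\<close>.\<close>
  define c where "c = real l / 2 + real l * (real l + 1) / (2 * (real k - 1))"
  have q: "real q \<ge> 1"
    using assms(1) by (simp flip: assms(1) add: Suc_leI)
  have "(\<Sum>x\<in>UNIV. (real (diff_rep A x))\<^sup>2) = real (\<Sum>x\<in>UNIV. (rep A x)\<^sup>2)"
    by (simp add: sum_rep_squared_eq_sum_diff_rep_squared)
  also have "\<dots> \<le> real (k * (card A)\<^sup>2 + l * (k + l) * card A)"
    using sum_rep_squared_le[of A k l] assms(3,4) of_nat_le_iff by blast
  also have "\<dots> = n\<^sup>2 + (real k - 1) * (n\<^sup>2 + 2 * c * n)"
    using assms(2) by (simp add: n_def c_def field_simps power2_eq_square)
  finally have "(\<Sum>x\<in>UNIV. (real (diff_rep A x))\<^sup>2) - n\<^sup>2 \<le> (real k - 1) * (n\<^sup>2 + 2 * c * n)"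
    by simp
  then have "(n * (n - 1))\<^sup>2 \<le> (real q - 1) * ((real k - 1) * (n\<^sup>2 + 2 * c * n))"
    using sum_diff_rep_squared_ge[of A] q assms(1) unfolding n_def
    by (smt (verit) mult_left_mono)
  moreover have "c \<ge> 0"
    using assms(2) by (simp add: c_def)
  ultimately have "n < sqrt ((real k - 1) * real q) + 1 + c"
    using q assms(2) by (intro real_bound_of_energy_bound) auto
  then show ?thesis
    by (simp add: n_def c_def add.assoc)
qed

end
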